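(* For every $n\geq 4$, the wheel $W_n$ satisfies: (1) $W_n\in\mathfrak{T}$; (2) $w_\tau(W_n)=n+2$ if $n=4$, and $w_\tau(W_n)=n$ if $n\geq 5$; (3) $W_\tau(W_n)=n+3$ if $4\leq n\leq 8$, and $W_\tau(W_n)=n+4$ if $n\geq 9$; (4) for every integer $t$ with $w_\tau(W_n)\leq t\leq W_\tau(W_n)$, $W_n\in\mathfrak{T}_t$.
   Context: All graphs are finite, undirected, without loops or multiple edges. For $n\geq 4$ the wheel $W_n$ has vertex set $\{u,v_1,\ldots,v_{n-1}\}$ and edge set $\{uv_i:1\leq i\leq n-1\}\cup\{v_iv_{i+1}:1\leq i\leq n-2\}\cup\{v_1v_{n-1}\}$ (so $W_n$ has $n$ vertices). A total coloring of a graph $G$ is an assignment of colors to the vertices and edges of $G$ such that no two adjacent vertices, no two adjacent edges, and no vertex and an edge incident to it receive the same color. For a positive integer $t$, an interval total $t$-coloring of $G$ is a total coloring of $G$ with colors $1,2,\ldots,t$ such that each color $i\in\{1,\ldots,t\}$ is used on at least one vertex or edge, and for each vertex $v$ the set consisting of the color of $v$ and the colors of the edges incident to $v$ consists of $d_G(v)+1$ consecutive integers, where $d_G(v)$ is the degree of $v$. $\mathfrak{T}_t$ denotes the set of graphs having an interval total $t$-coloring, and $\mathfrak{T}=\bigcup_{t\geq 1}\mathfrak{T}_t$. For $G\in\mathfrak{T}$, $w_\tau(G)$ and $W_\tau(G)$ denote the least and the greatest $t$ such that $G\in\mathfrak{T}_t$. *)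

theory Defs
  imports Main
begin

record 'a graph =
  verts :: "'a set"
  edges :: "'a set set"

definition simple_graph :: "'a graph \<Rightarrow> bool" where
  "simple_graph G \<longleftrightarrow>
     finite (verts G) \<and> (\<forall>e\<in>edges G. e \<subseteq> verts G \<and> card e = 2)"

definition incident_edges :: "'a graph \<Rightarrow> 'a \<Rightarrow> 'a set set" where
  "incident_edges G v = {e \<in> edges G. v \<in> e}"

definition degree :: "'a graph \<Rightarrow> 'a \<Rightarrow> nat" where
  "degree G v = card (incident_edges G v)"

text \<open>A coloring is given by its restrictions to the vertices and to the edges; values
  off the graph are irrelevant.\<close>

definition total_coloring :: "'a graph \<Rightarrow> ('a \<Rightarrow> nat) \<Rightarrow> ('a set \<Rightarrow> nat) \<Rightarrow> bool" where
  "total_coloring G cv ce \<longleftrightarrow>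
     (\<forall>x\<in>verts G. \<forall>y\<in>verts G. {x, y} \<in> edges G \<longrightarrow> cv x \<noteq> cv y) \<and>
     (\<forall>e\<in>edges G. \<forall>e'\<in>edges G. e \<noteq> e' \<and> e \<inter> e' \<noteq> {} \<longrightarrow> ce e \<noteq> ce e') \<and>
     (\<forall>v\<in>verts G. \<forall>e\<in>incident_edges G v. cv v \<noteq> ce e)"

definition interval_total_coloring ::
  "'a graph \<Rightarrow> nat \<Rightarrow> ('a \<Rightarrow> nat) \<Rightarrow> ('a set \<Rightarrow> nat) \<Rightarrow> bool" where
  "interval_total_coloring G t cv ce \<longleftrightarrow>
     total_coloring G cv ce \<and>
     cv ` verts G \<union> ce ` edges G = {1..t} \<and>
     (\<forall>v\<in>verts G. \<exists>a. insert (cv v) (ce ` incident_edges G v) = {a..a + degree G v})"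

definition interval_total_colorable :: "nat \<Rightarrow> 'a graph set" ("\<TT>\<^bsub>_\<^esub>") where
  "\<TT>\<^bsub>t\<^esub> = {G. simple_graph G \<and> 1 \<le> t \<and> (\<exists>cv ce. interval_total_coloring G t cv ce)}"

definition interval_total_graphs :: "'a graph set" ("\<TT>") where
  "\<TT> = (\<Union>t\<in>{1..}. \<TT>\<^bsub>t\<^esub>)"

text \<open>Both are meaningful only for \<open>G \<in> \<TT>\<close>; there the greatest element exists
  because \<open>t\<close> is at most the number of vertices plus the number of edges.\<close>

definition w_tau :: "'a graph \<Rightarrow> nat" where
  "w_tau G = (LEAST t. G \<in> \<TT>\<^bsub>t\<^esub>)"

definition W_tau :: "'a graph \<Rightarrow> nat" where
  "W_tau G = (GREATEST t. G \<in> \<TT>\<^bsub>t\<^esub>)"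

text \<open>\<open>wheel n\<close> has \<open>n\<close> vertices in all: the hub and a rim of \<open>n - 1\<close>. It is a wheel
  only for \<open>n \<ge> 4\<close>.\<close>

datatype wheel_vertex = Hub | Rim nat

definition wheel :: "nat \<Rightarrow> wheel_vertex graph" where
  "wheel n =
     \<lparr> verts = insert Hub (Rim ` {1..n - 1}),
       edges = {{Hub, Rim i} | i. 1 \<le> i \<and> i \<le> n - 1} \<union>
               {{Rim i, Rim (i + 1)} | i. 1 \<le> i \<and> i \<le> n - 2} \<union>
               {{Rim 1, Rim (n - 1)}} \<rparr>"

end

theory Submission
  imports Defs
begin

text \<open>Let \<open>m = n - 1\<close> and let \<open>{a..a + m}\<close> be the hub palette. Every rim palette contains a spoke
  colour, so all colours lie in \<open>{a - 3..a + m + 3}\<close>. If \<open>a - 3\<close> occurs, then it is the colour of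
  a rim vertex, and going from there around the rim in both directions alternately, each spoke has
  to take the smallest colour left; then no colour exceeds \<open>a + m\<close>. The only other way to use more
  than \<open>n + 3\<close> colours is that the extreme colours are \<open>a - 2\<close> and \<open>a + m + 2\<close>. Then the rim edge
  colours climb from one extreme to the other on both arcs of the rim, by at most 3 at each vertex
  and without jumping over the hub colour, which takes \<open>m \<ge> 8\<close>. The colourings for all other
  numbers of colours let the spoke colours grow essentially in the same alternating order.\<close>

subsection \<open>Colourings of wheels as integer sequences\<close>

definition succ_rim :: "nat \<Rightarrow> nat \<Rightarrow> nat" where
  "succ_rim m i = (if i = m then 1 else i + 1)"

definition pred_rim :: "nat \<Rightarrow> nat \<Rightarrow> nat" where
  "pred_rim m i = (if i = 1 then m else i - 1)"

definition rim_edge :: "nat \<Rightarrow> nat \<Rightarrow> wheel_vertex set" where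
  "rim_edge m i = {Rim i, Rim (succ_rim m i)}"

definition spoke :: "nat \<Rightarrow> wheel_vertex set" where
  "spoke i = {Hub, Rim i}"

section \<open>Incidences in the wheel, with rim edges named by their first end\<close>

lemma verts_wheel: "verts (wheel (Suc m)) = insert Hub (Rim ` {1..m})"
  by (simp add: wheel_def)

lemma edges_wheel:
  assumes "3 \<le> m"
  shows "edges (wheel (Suc m)) = spoke ` {1..m} \<union> rim_edge m ` {1..m}"
proof -
  have spokes: "{{Hub, Rim i} | i. 1 \<le> i \<and> i \<le> m} = spoke ` {1..m}"
    by (auto simp: spoke_def)
  have rim: "{{Rim i, Rim (i + 1)} | i. 1 \<le> i \<and> i \<le> m - 1} \<union> {{Rim 1, Rim m}} = rim_edge m ` {1..m}"
  proof -
    have "{1..m} = insert m {1..m - 1}" using assms by auto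
    then have "rim_edge m ` {1..m} = insert (rim_edge m m) (rim_edge m ` {1..m - 1})" by simp
    also have "rim_edge m m = {Rim 1, Rim m}" by (auto simp: rim_edge_def succ_rim_def)
    also have "rim_edge m ` {1..m - 1} = (\<lambda>i. {Rim i, Rim (i + 1)}) ` {1..m - 1}"
      using assms by (intro image_cong) (auto simp: rim_edge_def succ_rim_def)
    finally show ?thesis by auto
  qed
  have "Suc m - 1 = m" "Suc m - 2 = m - 1" by simp_all
  then show ?thesis by (simp only: wheel_def graph.simps Un_assoc spokes rim)
qed

lemma succ_rim_range: "i \<in> {1..m} \<Longrightarrow> succ_rim m i \<in> {1..m}"
  by (auto simp: succ_rim_def)

lemma pred_rim_range: "i \<in> {1..m} \<Longrightarrow> pred_rim m i \<in> {1..m}"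
  by (auto simp: pred_rim_def)

lemma succ_rim_eq_iff: "i \<in> {1..m} \<Longrightarrow> j \<in> {1..m} \<Longrightarrow> succ_rim m i = j \<longleftrightarrow> i = pred_rim m j"
  by (auto simp: succ_rim_def pred_rim_def)

lemma inj_spoke: "inj_on spoke A"
  by (auto simp: inj_on_def spoke_def doubleton_eq_iff)

text \<open>With two rim vertices both rim edges would be the same set, hence
  \<open>3 \<le> m\<close>.\<close>

lemma inj_rim_edge: "3 \<le> m \<Longrightarrow> inj_on (rim_edge m) {1..m}"
  by (auto simp: inj_on_def rim_edge_def succ_rim_def doubleton_eq_iff split: if_splits)

lemma simple_wheel: "3 \<le> m \<Longrightarrow> simple_graph (wheel (Suc m))"
  unfolding simple_graph_def edges_wheel verts_wheel
  by (auto simp: spoke_def rim_edge_def succ_rim_def)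

lemma incident_Hub: "3 \<le> m \<Longrightarrow> incident_edges (wheel (Suc m)) Hub = spoke ` {1..m}"
  unfolding incident_edges_def edges_wheel by (auto simp: spoke_def rim_edge_def)

lemma incident_Rim:
  assumes "3 \<le> m" "i \<in> {1..m}"
  shows "incident_edges (wheel (Suc m)) (Rim i) = {spoke i, rim_edge m i, rim_edge m (pred_rim m i)}"
proof -
  have "Rim i \<in> rim_edge m j \<longleftrightarrow> j = i \<or> j = pred_rim m i" if "j \<in> {1..m}" for j
    using succ_rim_eq_iff[OF that assms(2)] by (auto simp: rim_edge_def)
  moreover have "Rim i \<in> spoke j \<longleftrightarrow> j = i" for j by (auto simp: spoke_def)
  ultimately show ?thesis
    unfolding incident_edges_def edges_wheel[OF assms(1)]
    using assms(2) pred_rim_range[OF assms(2)] by auto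
qed

lemma degree_Hub: "3 \<le> m \<Longrightarrow> degree (wheel (Suc m)) Hub = m"
  by (simp add: degree_def incident_Hub card_image inj_spoke)

lemma degree_Rim:
  assumes "3 \<le> m" "i \<in> {1..m}"
  shows "degree (wheel (Suc m)) (Rim i) = 3"
proof -
  have "pred_rim m i \<noteq> i" using assms by (auto simp: pred_rim_def)
  then have "rim_edge m i \<noteq> rim_edge m (pred_rim m i)"
    using inj_onD[OF inj_rim_edge[OF assms(1)]] assms(2) pred_rim_range[OF assms(2)] by metis
  moreover have "spoke i \<noteq> rim_edge m j" for j by (auto simp: spoke_def rim_edge_def)
  ultimately show ?thesis by (simp add: degree_def incident_Rim[OF assms])
qed

text \<open>Integer colours allow translation and negation. Only conflicts between vertices are
  listed: a palette filling an interval with as many elements as there are objects at the vertex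
  forces their colours to be distinct.\<close>

definition wheel_colouring ::
  "nat \<Rightarrow> int \<Rightarrow> (nat \<Rightarrow> int) \<Rightarrow> (nat \<Rightarrow> int) \<Rightarrow> (nat \<Rightarrow> int) \<Rightarrow> bool" where
  "wheel_colouring m h c s r \<longleftrightarrow>
    (\<exists>a. insert h (s ` {1..m}) = {a..a + int m}) \<and>
    (\<forall>i\<in>{1..m}. c i \<noteq> h \<and> c i \<noteq> c (succ_rim m i) \<and>
      (\<exists>x. {c i, s i, r i, r (pred_rim m i)} = {x..x + 3}))"

definition wheel_colours ::
  "nat \<Rightarrow> int \<Rightarrow> (nat \<Rightarrow> int) \<Rightarrow> (nat \<Rightarrow> int) \<Rightarrow> (nat \<Rightarrow> int) \<Rightarrow> int set" where
  "wheel_colours m h c s r = insert h (c ` {1..m} \<union> s ` {1..m} \<union> r ` {1..m})"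

lemma wheel_colouring_if_colourable:
  assumes "3 \<le> m" "wheel (Suc m) \<in> \<TT>\<^bsub>t\<^esub>"
  obtains h c s r where "wheel_colouring m h c s r" "wheel_colours m h c s r = {1..int t}"
proof -
  let ?G = "wheel (Suc m)"
  obtain cv ce where "interval_total_coloring ?G t cv ce"
    using assms(2) by (auto simp: interval_total_colorable_def)
  then have total: "total_coloring ?G cv ce"
    and colours: "cv ` verts ?G \<union> ce ` edges ?G = {1..t}"
    and palette: "\<And>v. v \<in> verts ?G \<Longrightarrow> \<exists>a. insert (cv v) (ce ` incident_edges ?G v) = {a..a + degree ?G v}"
    by (auto simp: interval_total_coloring_def)
  define h c s r where "h = int (cv Hub)" and "c i = int (cv (Rim i))"
    and "s i = int (ce (spoke i))" and "r i = int (ce (rim_edge m i))" for i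
  note defs = h_def c_def s_def r_def
  obtain a where "insert (cv Hub) (ce ` spoke ` {1..m}) = {a..a + m}"
    using palette[of Hub] assms(1) by (auto simp: verts_wheel incident_Hub degree_Hub)
  then have "int ` insert (cv Hub) (ce ` spoke ` {1..m}) = {int a..int a + int m}"
    by (simp only: image_int_atLeastAtMost of_nat_add)
  then have "insert h (s ` {1..m}) = {int a..int a + int m}"
    by (simp add: defs image_image)
  moreover have "c i \<noteq> h" if "i \<in> {1..m}" for i
  proof -
    have "{Rim i, Hub} \<in> edges ?G"
      using that by (auto simp: edges_wheel[OF assms(1)] spoke_def insert_commute)
    then show ?thesis
      using total that by (auto simp: total_coloring_def verts_wheel defs)
  qed
  moreover have "c i \<noteq> c (succ_rim m i)" if "i \<in> {1..m}" for i
  proof -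
    have "{Rim i, Rim (succ_rim m i)} \<in> edges ?G"
      using that by (auto simp: edges_wheel[OF assms(1)] rim_edge_def)
    then show ?thesis
      using total that succ_rim_range[OF that] by (auto simp: total_coloring_def verts_wheel defs)
  qed
  moreover have "\<exists>x. {c i, s i, r i, r (pred_rim m i)} = {x..x + 3}" if i: "i \<in> {1..m}" for i
  proof -
    obtain a where "insert (cv (Rim i)) (ce ` incident_edges ?G (Rim i)) = {a..a + 3}"
      using palette[of "Rim i"] i degree_Rim[OF assms(1) i] by (auto simp: verts_wheel)
    then have "int ` insert (cv (Rim i)) (ce ` incident_edges ?G (Rim i)) = {int a..int a + 3}"
      by (simp add: image_int_atLeastAtMost)
    then have "{c i, s i, r i, r (pred_rim m i)} = {int a..int a + 3}"
      by (simp add: defs incident_Rim[OF assms(1) i])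
    then show ?thesis by blast
  qed
  ultimately have "wheel_colouring m h c s r"
    unfolding wheel_colouring_def by blast
  moreover have "wheel_colours m h c s r = int ` (cv ` verts ?G \<union> ce ` edges ?G)"
    by (simp add: wheel_colours_def defs verts_wheel edges_wheel[OF assms(1)] image_Un image_image Un_assoc)
  then have "wheel_colours m h c s r = {1..int t}"
    by (simp add: colours image_int_atLeastAtMost)
  ultimately show thesis by (rule that)
qed

text \<open>A palette with as many colours as a proper colouring of the star around a vertex needs
  already forces that colouring to be proper.\<close>

lemma interval_total_coloringI:
  assumes "simple_graph G"
    and proper: "\<And>x y. {x, y} \<in> edges G \<Longrightarrow> cv x \<noteq> cv y"
    and colours: "cv ` verts G \<union> ce ` edges G = {1..t}"
    and palette: "\<And>v. v \<in> verts G \<Longrightarrow>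
      \<exists>a. insert (cv v) (ce ` incident_edges G v) = {a..a + degree G v}"
  shows "interval_total_coloring G t cv ce"
proof -
  have star: "inj_on ce (incident_edges G v) \<and> cv v \<notin> ce ` incident_edges G v" if v: "v \<in> verts G" for v
  proof -
    have "edges G \<subseteq> Pow (verts G)" "finite (verts G)"
      using assms(1) by (auto simp: simple_graph_def)
    then have "incident_edges G v \<subseteq> Pow (verts G)" "finite (Pow (verts G))"
      by (auto simp: incident_edges_def)
    then have fin: "finite (incident_edges G v)" by (rule finite_subset)
    obtain a where "insert (cv v) (ce ` incident_edges G v) = {a..a + degree G v}"
      using palette[OF v] by (rule exE)
    then have "card (insert (cv v) (ce ` incident_edges G v)) = Suc (card (incident_edges G v))"
      by (simp add: degree_def)
    moreover have "card (ce ` incident_edges G v) \<le> card (incident_edges G v)"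
      using fin by (rule card_image_le)
    ultimately have "cv v \<notin> ce ` incident_edges G v" "card (ce ` incident_edges G v) = card (incident_edges G v)"
      using fin by (auto simp: card_insert_if split: if_splits)
    then show ?thesis using eq_card_imp_inj_on[OF fin] by blast
  qed
  have "ce e \<noteq> ce e'" if e: "e \<in> edges G" "e' \<in> edges G" "e \<noteq> e'" "e \<inter> e' \<noteq> {}" for e e'
  proof -
    obtain v where v: "v \<in> e" "v \<in> e'" using e by blast
    then have "v \<in> verts G" using e assms(1) by (auto simp: simple_graph_def)
    then show ?thesis
      using star[of v] e v by (auto simp: inj_on_def incident_edges_def)
  qed
  moreover have "cv v \<noteq> ce e" if "v \<in> verts G" "e \<in> incident_edges G v" for v e
    using star[OF that(1)] that(2) by auto
  ultimately have "total_coloring G cv ce"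
    using proper unfolding total_coloring_def by simp
  then show ?thesis
    unfolding interval_total_coloring_def using colours palette by (intro conjI ballI)
qed

lemma colourable_if_wheel_colouring:
  assumes m: "3 \<le> m" and col: "wheel_colouring m h c s r"
    and colours: "wheel_colours m h c s r = {lo..hi}"
  shows "wheel (Suc m) \<in> \<TT>\<^bsub>nat (hi - lo + 1)\<^esub>"
proof -
  let ?G = "wheel (Suc m)" and ?t = "nat (hi - lo + 1)"
  \<comment> \<open>Translation taking \<open>lo\<close> to colour 1; truncation by
    \<open>nat\<close> is harmless since no colour lies below \<open>lo\<close>.\<close>
  define f where "f x = nat (x - lo + 1)" for x
  define cv where "cv v = f (case v of Hub \<Rightarrow> h | Rim i \<Rightarrow> c i)" for v
  \<comment> \<open>Among the edges of the wheel the spokes are those containing \<open>Hub\<close>;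
    \<open>inv_into\<close> recovers the label.\<close>
  define ce where "ce e = f (if Hub \<in> e then s (inv_into {1..m} spoke e) else r (inv_into {1..m} (rim_edge m) e))" for e
  have cv: "cv Hub = f h" "cv (Rim i) = f (c i)" for i by (simp_all add: cv_def)
  have ce: "ce (spoke i) = f (s i)" "ce (rim_edge m i) = f (r i)" if "i \<in> {1..m}" for i
  proof -
    have "Hub \<in> spoke i" "Hub \<notin> rim_edge m i" by (auto simp: spoke_def rim_edge_def)
    then show "ce (spoke i) = f (s i)" "ce (rim_edge m i) = f (r i)"
      using that by (simp_all add: ce_def inv_into_f_f[OF inj_spoke that] inv_into_f_f[OF inj_rim_edge[OF m] that] del: One_nat_def)
  qed
  have lo: "lo \<le> x" if "x \<in> wheel_colours m h c s r" for x using that colours by simp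
  have inj: "f x = f y \<longleftrightarrow> x = y"
    if "x \<in> wheel_colours m h c s r" "y \<in> wheel_colours m h c s r" for x y
    using lo[OF that(1)] lo[OF that(2)] by (auto simp: f_def)
  have f_interval: "\<exists>b. f ` {x..x + int d} = {b..b + d}" if "lo \<le> x" for x d
  proof
    have "f ` {x..x + int d} = {f x..f x + d}"
    proof (intro equalityI subsetI)
      fix y assume "y \<in> {f x..f x + d}"
      then have "f (int y + lo - 1) = y" "int y + lo - 1 \<in> {x..x + int d}"
        using that by (auto simp: f_def)
      then show "y \<in> f ` {x..x + int d}" by (metis imageI)
    qed (use that in \<open>auto simp: f_def\<close>)
    then show "f ` {x..x + int d} = {f x..f x + d}" .
  qed
  have mem: "h \<in> wheel_colours m h c s r"
    "i \<in> {1..m} \<Longrightarrow> {c i, s i, r i} \<subseteq> wheel_colours m h c s r" for i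
    by (auto simp: wheel_colours_def)
  have "interval_total_coloring ?G ?t cv ce"
  proof (rule interval_total_coloringI[OF simple_wheel[OF m]])
    fix x y assume "{x, y} \<in> edges ?G"
    then obtain i where i: "i \<in> {1..m}" "{x, y} = {Hub, Rim i} \<or> {x, y} = {Rim i, Rim (succ_rim m i)}"
      by (auto simp: edges_wheel[OF m] spoke_def rim_edge_def)
    have "c i \<noteq> h" "c i \<noteq> c (succ_rim m i)"
      using col i(1) by (auto simp: wheel_colouring_def)
    then have "f (c i) \<noteq> f h" "f (c i) \<noteq> f (c (succ_rim m i))"
      using inj mem(1) mem(2)[OF i(1)] mem(2)[OF succ_rim_range[OF i(1)]] by auto
    then show "cv x \<noteq> cv y"
      using i(2) cv by (auto simp: doubleton_eq_iff)
  next
    have "cv ` verts ?G \<union> ce ` edges ?G = f ` wheel_colours m h c s r"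
      by (simp add: wheel_colours_def verts_wheel edges_wheel[OF m] image_Un image_image cv ce Un_assoc
          cong: image_cong_simp)
    also have "\<dots> = {1..?t}"
    proof (intro equalityI subsetI)
      fix y assume y: "y \<in> {1..?t}"
      then have "f (int y + lo - 1) = y" "int y + lo - 1 \<in> {lo..hi}"
        by (auto simp: f_def)
      then show "y \<in> f ` wheel_colours m h c s r" unfolding colours by (metis imageI)
    qed (auto simp: f_def colours)
    finally show "cv ` verts ?G \<union> ce ` edges ?G = {1..?t}" .
  next
    fix v assume "v \<in> verts ?G"
    then consider "v = Hub" | i where "v = Rim i" "i \<in> {1..m}" by (auto simp: verts_wheel)
    then show "\<exists>a. insert (cv v) (ce ` incident_edges ?G v) = {a..a + degree ?G v}"
    proof cases
      case 1
      obtain a where a: "insert h (s ` {1..m}) = {a..a + int m}"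
        using col by (auto simp: wheel_colouring_def)
      have "insert (cv v) (ce ` incident_edges ?G v) = f ` insert h (s ` {1..m})"
        by (simp add: 1 incident_Hub[OF m] image_image cv ce cong: image_cong_simp)
      moreover have "a \<in> insert h (s ` {1..m})" unfolding a by simp
      then have "lo \<le> a" by (intro lo) (auto simp: wheel_colours_def)
      ultimately show ?thesis
        using f_interval[of a m] by (simp only: a 1 degree_Hub[OF m])
    next
      case 2
      obtain x where x: "{c i, s i, r i, r (pred_rim m i)} = {x..x + 3}"
        using col 2(2) unfolding wheel_colouring_def by blast
      have "insert (cv v) (ce ` incident_edges ?G v) = f ` {c i, s i, r i, r (pred_rim m i)}"
        by (simp add: 2(1) incident_Rim[OF m 2(2)] cv ce[OF 2(2)] ce[OF pred_rim_range[OF 2(2)]])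
      moreover have "x \<in> {c i, s i, r i, r (pred_rim m i)}" unfolding x by simp
      then have "lo \<le> x" using mem(2)[OF 2(2)] mem(2)[OF pred_rim_range[OF 2(2)]] by (intro lo) auto
      ultimately show ?thesis
        using f_interval[of x 3] by (simp only: x 2(1) degree_Rim[OF m 2(2)] of_nat_numeral)
    qed
  qed
  moreover have "lo \<le> hi" using mem(1) colours by simp
  ultimately show ?thesis
    using simple_wheel[OF m] by (auto simp: interval_total_colorable_def)
qed

subsection \<open>The upper bound\<close>

text \<open>The interval has four elements, so a list of four entries that exhausts it has no
  repetition.\<close>

lemma four_consecutive:
  fixes p q r s x :: int
  assumes "{p, q, r, s} = {x..x + 3}"
  shows "distinct [p, q, r, s]" "set [p, q, r, s] \<subseteq> {x..x + 3}"
    "y \<in> {x..x + 3} \<Longrightarrow> y = p \<or> y = q \<or> y = r \<or> y = s"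
proof -
  have "set [p, q, r, s] = {x..x + 3}" using assms by simp
  then have "card (set [p, q, r, s]) = length [p, q, r, s]" by simp
  then show "distinct [p, q, r, s]" by (rule card_distinct)
  show "set [p, q, r, s] \<subseteq> {x..x + 3}" using assms by (simp only: list.set subset_refl)
  show "y = p \<or> y = q \<or> y = r \<or> y = s" if "y \<in> {x..x + 3}"
    using that unfolding assms[symmetric] by simp
qed

text \<open>The rim is unrolled to all integers with period \<open>m\<close>, so that walks in
  either direction need no wrap-around; \<open>R k\<close> belongs to the edge from \<open>k\<close>
  to \<open>k + 1\<close>.\<close>

locale wheel_walk =
  fixes m h a :: int and C S R :: "int \<Rightarrow> int"
  assumes m_ge: "3 \<le> m"
    and periodic: "m dvd j - k \<Longrightarrow> C j = C k \<and> S j = S k \<and> R j = R k"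
    and spoke_inj: "S j = S k \<Longrightarrow> m dvd j - k"
    and hub_palette: "insert h (range S) = {a..a + m}"
    and spoke_ne_hub: "S k \<noteq> h"
    and rim_ne_hub: "C k \<noteq> h"
    and rim_ne_next: "C k \<noteq> C (k + 1)"
    and rim_palette: "\<exists>x. {C k, S k, R k, R (k - 1)} = {x..x + 3}"
begin

lemma hub_range: "a \<le> h" "h \<le> a + m"
  using hub_palette by auto

lemma spoke_range: "a \<le> S k" "S k \<le> a + m"
  using hub_palette by auto

lemma palette:
  obtains x where "C k \<in> {x..x + 3}" "S k \<in> {x..x + 3}" "R k \<in> {x..x + 3}" "R (k - 1) \<in> {x..x + 3}"
    "C k \<noteq> S k" "C k \<noteq> R k" "C k \<noteq> R (k - 1)" "S k \<noteq> R k" "S k \<noteq> R (k - 1)" "R k \<noteq> R (k - 1)"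
    "\<And>y. x \<le> y \<Longrightarrow> y \<le> x + 3 \<Longrightarrow> y = C k \<or> y = S k \<or> y = R k \<or> y = R (k - 1)"
proof -
  obtain x where x: "{C k, S k, R k, R (k - 1)} = {x..x + 3}" using rim_palette by blast
  show thesis
    using four_consecutive[OF x] by (intro that[of x]) auto
qed

section \<open>Symmetries of the walk\<close>

lemma shift: "wheel_walk m h a (\<lambda>k. C (k + d)) (\<lambda>k. S (k + d)) (\<lambda>k. R (k + d))"
proof
  fix j k
  show "m dvd j - k \<Longrightarrow> C (j + d) = C (k + d) \<and> S (j + d) = S (k + d) \<and> R (j + d) = R (k + d)"
    by (rule periodic) simp
  show "S (j + d) = S (k + d) \<Longrightarrow> m dvd j - k"
    using spoke_inj[of "j + d" "k + d"] by simp
  have "range (\<lambda>k. S (k + d)) = S ` range (\<lambda>k. k + d)" by (simp only: image_image)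
  then show "insert h (range (\<lambda>k. S (k + d))) = {a..a + m}"
    using hub_palette by simp
  show "C (k + d) \<noteq> C (k + 1 + d)"
    using rim_ne_next[of "k + d"] by (simp add: ac_simps)
  show "\<exists>x. {C (k + d), S (k + d), R (k + d), R (k - 1 + d)} = {x..x + 3}"
    using rim_palette[of "k + d"] by (simp add: algebra_simps)
qed (use m_ge spoke_ne_hub rim_ne_hub in auto)

text \<open>Reflection sends the edge from \<open>k\<close> to \<open>k + 1\<close> to the edge from
  \<open>- k - 1\<close> to \<open>- k\<close>, hence the index \<open>- k - 1\<close>.\<close>

lemma reverse: "wheel_walk m h a (\<lambda>k. C (- k)) (\<lambda>k. S (- k)) (\<lambda>k. R (- k - 1))"
proof
  fix j k
  have dvd: "m dvd - j - - k \<longleftrightarrow> m dvd j - k"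
    using dvd_diff_commute[of m j k] by simp
  then show "m dvd j - k \<Longrightarrow> C (- j) = C (- k) \<and> S (- j) = S (- k) \<and> R (- j - 1) = R (- k - 1)"
    using periodic[of "- j" "- k"] periodic[of "- j - 1" "- k - 1"] by simp
  show "S (- j) = S (- k) \<Longrightarrow> m dvd j - k"
    using spoke_inj[of "- j" "- k"] dvd by simp
  have "range (\<lambda>k. S (- k)) = S ` range uminus" by (simp only: image_image)
  then show "insert h (range (\<lambda>k. S (- k))) = {a..a + m}"
    using hub_palette by (simp add: surj_uminus)
  show "C (- k) \<noteq> C (- (k + 1))"
    using rim_ne_next[of "- k - 1"] by simp
  show "\<exists>x. {C (- k), S (- k), R (- k - 1), R (- (k - 1) - 1)} = {x..x + 3}"
    using rim_palette[of "- k"] by (simp add: insert_commute)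
qed (use m_ge spoke_ne_hub rim_ne_hub in auto)

text \<open>Exchanges low and high colours, so that results about the lower end of the hub palette
  carry over to the upper end.\<close>

lemma negate: "wheel_walk m (- h) (- a - m) (\<lambda>k. - C k) (\<lambda>k. - S k) (\<lambda>k. - R k)"
proof
  fix j k
  have "insert (- h) (range (\<lambda>k. - S k)) = uminus ` insert h (range S)" by auto
  then show "insert (- h) (range (\<lambda>k. - S k)) = {- a - m..- a - m + m}"
    using hub_palette by simp
  obtain x where "{C k, S k, R k, R (k - 1)} = {x..x + 3}" using rim_palette by blast
  then have "uminus ` {C k, S k, R k, R (k - 1)} = uminus ` {x..x + 3}" by simp
  then have "{- C k, - S k, - R k, - R (k - 1)} = {(- x - 3)..(- x - 3) + 3}" by simp
  then show "\<exists>x. {- C k, - S k, - R k, - R (k - 1)} = {x..x + 3}" by blast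
  show "m dvd j - k \<Longrightarrow> - C j = - C k \<and> - S j = - S k \<and> - R j = - R k"
    using periodic[of j k] by simp
  show "- S j = - S k \<Longrightarrow> m dvd j - k"
    using spoke_inj[of j k] by simp
qed (use m_ge spoke_ne_hub rim_ne_hub rim_ne_next in auto)

text \<open>Labels the walk in the order \<open>0, -1, 1, -2, 2, \<dots>\<close>.\<close>

definition zigzag :: "int \<Rightarrow> int" where
  "zigzag j = (if even j then j div 2 else - ((j + 1) div 2))"

text \<open>The first \<open>m\<close> zigzag positions are distinct and less than \<open>m\<close>
  apart, hence incongruent modulo \<open>m\<close>.\<close>

lemma spoke_zigzag_inj:
  assumes "0 \<le> i" "i < j" "j < m"
  shows "S (zigzag i) \<noteq> S (zigzag j)"
proof
  assume "S (zigzag i) = S (zigzag j)"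
  then have "m dvd zigzag i - zigzag j" by (rule spoke_inj)
  moreover have "zigzag i \<noteq> zigzag j" "\<bar>zigzag i - zigzag j\<bar> < m"
    using assms unfolding zigzag_def by (auto split: if_splits; presburger)+
  ultimately show False using zdvd_not_zless by (metis abs_ge_self abs_dvd_iff dvd_abs_iff right_minus_eq zero_less_abs_iff)
qed

text \<open>The smallest unused spoke colour is forced at every step of the zigzag, so the hub colour
  can only be the largest colour of the hub palette.\<close>

lemma spoke_zigzag:
  assumes "S 0 = a" "R (- 1) \<le> a - 2" "R 0 \<le> a - 1" and "0 \<le> j" "j < m"
  shows "S (zigzag j) = a + j \<and>
    (1 \<le> j \<longrightarrow> R (if even j then zigzag j - 1 else zigzag j) \<le> a + j - 3)"
  using assms(4,5)
proof (induction "nat j" arbitrary: j rule: less_induct)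
  case less
  show ?case
  proof (cases "j = 0")
    case True
    then show ?thesis using assms by (simp add: zigzag_def)
  next
    case False
    let ?e = "if even j then zigzag j - 1 else zigzag j"
    \<comment> \<open>\<open>?e\<close> is the edge through which the zigzag reaches its vertex,
      coming from the side of vertex \<open>0\<close>. The assumptions give the bound for the first
      two steps.\<close>
    have edge: "R ?e \<le> a + j - 3"
    proof (cases "j \<le> 2")
      case True
      then have "j = 1 \<or> j = 2" using False less.prems by auto
      then show ?thesis using assms by (auto simp: zigzag_def)
    next
      case False
      define k where "k = zigzag (j - 2)"
      have IH: "S k = a + (j - 2)" "R (if even j then k - 1 else k) \<le> a + (j - 2) - 3"
        using less.hyps[of "j - 2"] less.prems False by (auto simp: k_def)
      have e: "?e = (if even j then k else k - 1)"
        unfolding k_def zigzag_def by (auto; presburger)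
      \<comment> \<open>At \<open>k\<close> the incoming edge and the spoke differ by at least 3, so
        they are the two ends of the palette and the other edge stays below the spoke.\<close>
      show ?thesis
        unfolding e by (rule palette[of k]) (use IH in \<open>auto split: if_splits\<close>)
    qed
    \<comment> \<open>Sharing a palette with \<open>?e\<close> bounds the spoke from above; the
      colours from \<open>a\<close> to \<open>a + j - 1\<close> are taken by earlier spokes.\<close>
    have "S (zigzag j) \<le> a + j"
      by (rule palette[of "zigzag j"]) (use edge in \<open>auto split: if_splits\<close>)
    moreover have "S (zigzag j) \<noteq> a + i" if "0 \<le> i" "i < j" for i
      using less.hyps[of i] less.prems that spoke_zigzag_inj[OF that less.prems(2)] by auto
    from this[of "S (zigzag j) - a"] have "\<not> S (zigzag j) < a + j"
      using spoke_range by auto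
    ultimately show ?thesis using edge by auto
  qed
qed

text \<open>Residues below \<open>m / 2\<close> are reached on the even side, the others, lowered by
  \<open>m\<close>, on the odd side.\<close>

lemma zigzag_surj:
  obtains j where "0 \<le> j" "j < m" "m dvd k - zigzag j"
proof -
  define i where "i = k mod m"
  have i: "0 \<le> i" "i < m" "m dvd k - i"
    using m_ge by (auto simp: i_def mod_eq_dvd_iff[symmetric])
  show thesis
  proof (cases "2 * i < m")
    case True
    then show thesis using i by (intro that[of "2 * i"]) (auto simp: zigzag_def)
  next
    case False
    have "m dvd k - (i - m)" using i by (simp add: diff_diff_eq2 diff_add_eq[symmetric])
    moreover have "zigzag (2 * (m - i) - 1) = i - m" by (simp add: zigzag_def)
    ultimately show thesis
      using False i by (intro that[of "2 * (m - i) - 1"]) simp_all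
  qed
qed

text \<open>For \<open>1 \<le> j\<close> the incoming edge has colour at most
  \<open>a + j - 3\<close>, so its palette ends by \<open>a + j\<close>, and \<open>j < m\<close>.
  The palette at \<open>0\<close> ends by \<open>a + 1\<close>.\<close>

lemma colour_bound_if_zigzag:
  assumes "S 0 = a" "R (- 1) \<le> a - 2" "R 0 \<le> a - 1"
  shows "C k \<le> a + m" "R k \<le> a + m"
proof -
  obtain j where j: "0 \<le> j" "j < m" "m dvd k - zigzag j" by (rule zigzag_surj)
  note z = spoke_zigzag[OF assms j(1,2)]
  have "C (zigzag j) \<le> a + m \<and> R (zigzag j) \<le> a + m"
  proof (cases "j = 0")
    case True
    show ?thesis
      by (rule palette[of 0]) (use True assms m_ge in \<open>auto simp: zigzag_def\<close>)
  next
    case False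
    show ?thesis
      by (rule palette[of "zigzag j"]) (use z j False in \<open>auto split: if_splits\<close>)
  qed
  then show "C k \<le> a + m" "R k \<le> a + m" using periodic[OF j(3)] by auto
qed

lemma colour_bound_if_low0:
  assumes "C 0 \<le> a - 3 \<or> R 0 \<le> a - 3"
  shows "C k \<le> a + m" "R k \<le> a + m"
proof -
  \<comment> \<open>A rim edge of lower colour would force spoke colour \<open>a\<close> at both its
    ends, against \<open>spoke_inj\<close>.\<close>
  have R: "R j \<ge> a - 2" for j
  proof (rule ccontr)
    assume l: "\<not> a - 2 \<le> R j"
    have "S j \<le> a" by (rule palette[of j]) (use l in auto)
    moreover have "S (j + 1) \<le> a" by (rule palette[of "j + 1"]) (use l in auto)
    ultimately have "S (j + 1) = S j" using spoke_range[of j] spoke_range[of "j + 1"] by simp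
    then have "m dvd 1" using spoke_inj by fastforce
    then show False using m_ge by simp
  qed
  have c: "C 0 \<le> a - 3" using assms R[of 0] by auto
  \<comment> \<open>The palette at \<open>0\<close> is \<open>{a - 3..a}\<close>, with rim edges
    coloured \<open>a - 2\<close> and \<open>a - 1\<close> in some order; reversing the walk
    exchanges the two orders.\<close>
  have s: "S 0 = a" "R 0 \<le> a - 1" "R (- 1) \<le> a - 1" "R 0 \<noteq> R (- 1)"
    by (rule palette[of 0]; use c spoke_range[of 0] in auto)+
  consider "R (- 1) \<le> a - 2" | "R 0 \<le> a - 2" using s by linarith
  then have "C k \<le> a + m \<and> R k \<le> a + m"
  proof cases
    case 1
    then show ?thesis using colour_bound_if_zigzag s by simp
  next
    case 2
    interpret rev: wheel_walk m h a "\<lambda>k. C (- k)" "\<lambda>k. S (- k)" "\<lambda>k. R (- k - 1)"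
      by (rule reverse)
    show ?thesis
      using rev.colour_bound_if_zigzag[of "- k"] rev.colour_bound_if_zigzag[of "- k - 1"] 2 s by simp
  qed
  then show "C k \<le> a + m" "R k \<le> a + m" by auto
qed

lemma colour_bound_if_low:
  assumes "C i \<le> a - 3 \<or> R i \<le> a - 3"
  shows "C k \<le> a + m" "R k \<le> a + m"
proof -
  interpret sh: wheel_walk m h a "\<lambda>k. C (k + i)" "\<lambda>k. S (k + i)" "\<lambda>k. R (k + i)"
    by (rule shift)
  show "C k \<le> a + m" "R k \<le> a + m"
    using sh.colour_bound_if_low0[of "k - i"] assms by auto
qed

text \<open>The hub colour occurs in a rim palette only as a rim edge colour, so the colours of
  consecutive rim edges never lie strictly on different sides of it.\<close>

definition height :: "int \<Rightarrow> int" where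
  "height x = (if h \<le> x then (x - h + 2) div 3 else - ((h - x + 2) div 3))"

text \<open>\<open>height\<close> is the signed distance from \<open>h\<close>, divided by 3 and
  rounded away from zero. Rounding is harmless on one side of \<open>h\<close>, but from
  \<open>h - 1\<close> to \<open>h + 1\<close> the value jumps by 2.\<close>

lemma height_lipschitz:
  assumes "(h \<le> y \<and> h \<le> z) \<or> (y \<le> h \<and> z \<le> h)" "\<bar>y - z\<bar> \<le> 3"
  shows "\<bar>height y - height z\<bar> \<le> 1"
proof -
  have div: "\<bar>u div 3 - v div 3\<bar> \<le> 1" if "\<bar>u - v\<bar> \<le> 3" for u v :: int
    using that by linarith
  have neg: "height w = - ((h - w + 2) div 3)" if "w \<le> h" for w
    using that by (auto simp: height_def)
  show ?thesis
    using assms(1)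
  proof
    assume "h \<le> y \<and> h \<le> z"
    then show ?thesis using div[of "y - h + 2" "z - h + 2"] assms(2) by (simp add: height_def)
  next
    assume "y \<le> h \<and> z \<le> h"
    then show ?thesis using div[of "h - y + 2" "h - z + 2"] assms(2) neg[of y] neg[of z] by linarith
  qed
qed

lemma height_step: "\<bar>height (R k) - height (R (k - 1))\<bar> \<le> 1"
proof -
  obtain x where x: "{C k, S k, R k, R (k - 1)} = {x..x + 3}" using rim_palette by blast
  have "\<bar>R k - R (k - 1)\<bar> \<le> 3" using four_consecutive(2)[OF x] by auto
  moreover have "(h \<le> R k \<and> h \<le> R (k - 1)) \<or> (R k \<le> h \<and> R (k - 1) \<le> h)"
    using four_consecutive(2)[OF x] four_consecutive(3)[OF x, of h] spoke_ne_hub[of k] rim_ne_hub[of k]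
    by force
  ultimately show ?thesis by (intro height_lipschitz)
qed

lemma height_walk: "\<bar>height (R (k + int d)) - height (R k)\<bar> \<le> int d"
proof (induction d)
  case (Suc d)
  have "k + int (Suc d) - 1 = k + int d" by simp
  then have "\<bar>height (R (k + int (Suc d))) - height (R (k + int d))\<bar> \<le> 1"
    using height_step[of "k + int (Suc d)"] by (simp only:)
  then show ?case using Suc.IH by linarith
qed simp

text \<open>The palette is \<open>{a - 2..a + 1}\<close> and neither edge colour exceeds
  \<open>h\<close>, where \<open>3 * height y \<le> y - h\<close>. Summing suffices unless the edges
  are coloured \<open>a - 1\<close> and \<open>a + 1\<close>; then rounding supplies the missing
  unit.\<close>

lemma height_low:
  assumes "C k = a - 2 \<or> R k = a - 2 \<or> R (k - 1) = a - 2"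
    and "a - 2 \<le> C k" "a - 2 \<le> R k" "a - 2 \<le> R (k - 1)"
  shows "3 * (height (R k) + height (R (k - 1))) \<le> - (2 * (h - a) + 1)"
proof -
  obtain x where x: "{C k, S k, R k, R (k - 1)} = {x..x + 3}" using rim_palette by blast
  note all = four_consecutive(3)[OF x]
  have p: "C k \<in> {x..x + 3}" "S k \<in> {x..x + 3}" "R k \<in> {x..x + 3}" "R (k - 1) \<in> {x..x + 3}"
    "S k \<noteq> R k" "S k \<noteq> R (k - 1)" "R k \<noteq> R (k - 1)"
    using four_consecutive(1,2)[OF x] by auto
  have x: "x = a - 2"
    using all[of x] assms p spoke_range[of k] by auto
  have S: "S k = a \<or> S k = a + 1" using p x spoke_range[of k] by auto
  have R: "R k \<in> {a - 2, a - 1, a, a + 1}" "R (k - 1) \<in> {a - 2, a - 1, a, a + 1}" using p x by auto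
  have h: "h \<noteq> S k" "h \<ge> a" using spoke_ne_hub[of k] hub_range by auto
  \<comment> \<open>Only \<open>a + 1\<close> could exceed \<open>h\<close>, and only for
    \<open>h = a\<close>; but then the spoke itself has colour \<open>a + 1\<close>.\<close>
  have le_h: "R k \<le> h" "R (k - 1) \<le> h" using S R h p(5,6) by auto
  have height: "3 * height y \<le> y - h" if "y \<le> h" for y
    using that unfolding height_def by auto
  show ?thesis
  proof (cases "R k + R (k - 1) \<le> 2 * a - 1")
    case True
    then show ?thesis using height[OF le_h(1)] height[OF le_h(2)] unfolding distrib_left by smt
  next
    case False
    then have "(R k = a - 1 \<and> R (k - 1) = a + 1) \<or> (R k = a + 1 \<and> R (k - 1) = a - 1)"
      using S R p(5-7) by auto
    then have "R k + R (k - 1) = 2 * a" "height (R k) + height (R (k - 1)) = height (a - 1) + height (a + 1)"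
      and "a + 1 \<le> h"
      using le_h by auto
    moreover have "2 * e + 1 \<le> 3 * ((e + 1) div 3 + (e + 3) div 3)" for e :: int
      by presburger
    from this[of "h - a"] have "3 * (height (a - 1) + height (a + 1)) \<le> - (2 * (h - a) + 1)"
      using \<open>a + 1 \<le> h\<close> by (auto simp: height_def algebra_simps)
    ultimately show ?thesis by (simp only:)
  qed
qed

text \<open>The two arcs between the palettes at \<open>i\<close> and \<open>k\<close> have
  \<open>d - 1\<close> and \<open>m - d - 1\<close> height steps, each of size at most 1, while
  \<open>height_low\<close> at both ends makes the total climb at least
  \<open>(2 * m + 2) / 3\<close>. Hence \<open>2 * m + 2 \<le> 3 * (m - 2)\<close>.\<close>

lemma rim_length:
  assumes low: "\<And>j. a - 2 \<le> C j" "\<And>j. a - 2 \<le> R j"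
    and high: "\<And>j. C j \<le> a + m + 2" "\<And>j. R j \<le> a + m + 2"
    and i: "C i = a - 2 \<or> R i = a - 2"
    and k: "C k = a + m + 2 \<or> R k = a + m + 2"
  shows "8 \<le> m"
proof -
  interpret neg: wheel_walk m "- h" "- a - m" "\<lambda>k. - C k" "\<lambda>k. - S k" "\<lambda>k. - R k"
    by (rule negate)
  have neg_height: "neg.height (- x) = - height x" for x
    unfolding height_def neg.height_def by auto
  have lo: "3 * (height (R i) + height (R (i - 1))) \<le> - (2 * (h - a) + 1)"
    by (rule height_low) (use low i in auto)
  have hi: "2 * (a + m - h) + 1 \<le> 3 * (height (R k) + height (R (k - 1)))"
    using neg.height_low[of k] high[of k] high[of "k - 1"] k by (auto simp: neg_height)
  \<comment> \<open>The number of forward steps from \<open>i\<close> to \<open>k\<close>, nonzero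
    because the height sums at the two vertices have opposite signs.\<close>
  define d where "d = (k - i) mod m"
  have "d \<noteq> 0"
  proof
    assume "d = 0"
    then have "m dvd k - i" by (auto simp: d_def)
    moreover from this have "m dvd (k - 1) - (i - 1)" by simp
    ultimately have "R k = R i" "R (k - 1) = R (i - 1)" using periodic by blast+
    then show False using lo hi hub_range m_ge by auto
  qed
  then have d: "0 < d" "d < m" using m_ge by (simp_all add: d_def less_le[of 0])
  have dvd: "m dvd k - (i + d)"
    unfolding d_def by (simp add: diff_diff_eq[symmetric] minus_mod_eq_mult_div)
  then have "m dvd (k - 1) - (i + (d - 1))" "m dvd k - (i + d)" by (auto simp: algebra_simps)
  then have right: "R (k - 1) = R (i + (d - 1))" using periodic by blast
  have "m dvd (i - 1) - (k + (m - d - 1))"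
  proof -
    have "(i - 1) - (k + (m - d - 1)) = - (k - (i + d)) - m" by simp
    then show ?thesis using dvd by (simp only: dvd_diff dvd_minus_iff dvd_refl)
  qed
  then have left: "R (i - 1) = R (k + (m - d - 1))" using periodic by blast
  have "\<bar>height (R (k - 1)) - height (R i)\<bar> \<le> d - 1"
    using height_walk[of i "nat (d - 1)"] d right by simp
  moreover have "\<bar>height (R (i - 1)) - height (R k)\<bar> \<le> m - d - 1"
    using height_walk[of k "nat (m - d - 1)"] d left by simp
  ultimately show ?thesis using lo hi by auto
qed

section \<open>The spread of all colours\<close>

lemma spread:
  assumes "insert h (range C \<union> range S \<union> range R) = {lo..hi}"
  shows "hi - lo \<le> m + 3 \<or> (hi - lo = m + 4 \<and> 8 \<le> m)"
proof -
  interpret neg: wheel_walk m "- h" "- a - m" "\<lambda>k. - C k" "\<lambda>k. - S k" "\<lambda>k. - R k"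
    by (rule negate)
  have in_range: "lo \<le> x \<and> x \<le> hi" if "x \<in> insert h (range C \<union> range S \<union> range R)" for x
    using that assms by auto
  have "lo \<le> hi" using in_range[of h] by auto
  then have lo: "lo = h \<or> (\<exists>i. lo = S i) \<or> (\<exists>i. C i = lo \<or> R i = lo)"
    and hi: "hi = h \<or> (\<exists>i. hi = S i) \<or> (\<exists>i. C i = hi \<or> R i = hi)"
    using assms by (auto simp: set_eq_iff image_iff)
  have "insert h (range S) \<subseteq> insert h (range C \<union> range S \<union> range R)" by blast
  then have "{a..a + m} \<subseteq> {lo..hi}" by (simp only: hub_palette assms)
  then have ends: "lo \<le> a" "a + m \<le> hi" using m_ge by auto
  have CR: "a - 3 \<le> C k" "a - 3 \<le> R k" "C k \<le> a + m + 3" "R k \<le> a + m + 3" for k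
    by (rule palette[of k]; use spoke_range[of k] in auto)+
  then have bounds: "a - 3 \<le> lo" "hi \<le> a + m + 3"
    using lo hi hub_range spoke_range by (smt (verit))+
  \<comment> \<open>The first two cases confine the opposite end to the hub palette, the next two
    are narrow enough as they stand, and only the last needs \<open>rim_length\<close>.\<close>
  consider "lo = a - 3" | "hi = a + m + 3" | "a - 2 < lo \<and> hi < a + m + 3" | "a - 3 < lo \<and> hi < a + m + 2"
    | "lo = a - 2" "hi = a + m + 2"
    using bounds by linarith
  then show ?thesis
  proof cases
    case 1
    then have "\<exists>i. C i \<le> a - 3 \<or> R i \<le> a - 3" using lo hub_range spoke_range by (smt (verit))
    then have "C k \<le> a + m" "R k \<le> a + m" for k using colour_bound_if_low by blast+
    then have "hi \<le> a + m" using hi hub_range spoke_range by (smt (verit))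
    then show ?thesis using 1 by simp
  next
    case 2
    then have "\<exists>i. - C i \<le> - a - m - 3 \<or> - R i \<le> - a - m - 3"
      using hi hub_range spoke_range by (smt (verit))
    then have "- C k \<le> - a - m + m" "- R k \<le> - a - m + m" for k
      using neg.colour_bound_if_low by blast+
    then have "a \<le> lo" using lo hub_range spoke_range by (smt (verit))
    then show ?thesis using 2 by simp
  next
    case 5
    have "8 \<le> m"
    proof -
      obtain i where i: "C i = a - 2 \<or> R i = a - 2"
        using lo 5 hub_range spoke_range by (smt (verit))
      obtain k where k: "C k = a + m + 2 \<or> R k = a + m + 2"
        using hi 5 hub_range spoke_range by (smt (verit))
      show ?thesis
        by (rule rim_length[OF _ _ _ _ i k]) (use in_range 5 in auto)
    qed
    then show ?thesis using 5 by simp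
  qed auto
qed

end

text \<open>Extending the colouring periodically over the integers yields a
  \<open>wheel_walk\<close>.\<close>

lemma spread_wheel_colouring:
  assumes m: "3 \<le> m" and col: "wheel_colouring m h c s r"
    and colours: "wheel_colours m h c s r = {lo..hi}"
  shows "hi - lo \<le> int m + 3 \<or> (hi - lo = int m + 4 \<and> 8 \<le> m)"
proof -
  \<comment> \<open>The representative of \<open>k\<close> modulo \<open>m\<close> in
    \<open>{1..m}\<close>; the two shifts by 1 let \<open>m\<close>, not \<open>0\<close>, represent
    the multiples of \<open>m\<close>.\<close>
  define idx where "idx k = Suc (nat ((k - 1) mod int m))" for k :: int
  have idx_range: "idx k \<in> {1..m}" for k
    using m by (simp add: idx_def Suc_le_eq nat_less_iff)
  have idx_eq: "idx j = idx k \<longleftrightarrow> int m dvd j - k" for j k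
  proof -
    have "idx j = idx k \<longleftrightarrow> (j - 1) mod int m = (k - 1) mod int m"
      using m by (simp add: idx_def eq_nat_nat_iff)
    also have "\<dots> \<longleftrightarrow> int m dvd (j - 1) - (k - 1)" by (rule mod_eq_dvd_iff)
    finally show ?thesis by simp
  qed
  have idx_int: "idx (int i) = i" if "i \<in> {1..m}" for i
    using that by (auto simp: idx_def nat_diff_distrib)
  have surj: "range idx = {1..m}"
    using idx_range idx_int by (auto simp: set_eq_iff image_iff) (metis le0 idx_int atLeastAtMost_iff One_nat_def)+
  have succ: "succ_rim m (idx k) = idx (k + 1)" for k
  proof -
    have "int (succ_rim m (idx k)) - (k + 1) = int (idx k) - k \<or>
      int (succ_rim m (idx k)) - (k + 1) = int (idx k) - k - int m"
      by (auto simp: succ_rim_def)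
    moreover have "int m dvd int (idx k) - k"
      using idx_eq[of "int (idx k)" k] idx_int[OF idx_range] by simp
    then obtain q where "int (idx k) - k = int m * q" by (rule dvdE)
    ultimately have "int (succ_rim m (idx k)) - (k + 1) = int m * q \<or>
      int (succ_rim m (idx k)) - (k + 1) = int m * (q - 1)"
      by (simp add: right_diff_distrib)
    then have "int m dvd int (succ_rim m (idx k)) - (k + 1)" by (metis dvd_triv_left)
    then show ?thesis
      using idx_eq idx_int[OF succ_rim_range[OF idx_range]] by metis
  qed
  have pred: "pred_rim m (idx k) = idx (k - 1)" for k
    using succ_rim_eq_iff[OF idx_range idx_range, of "k - 1" k] succ[of "k - 1"] by simp
  obtain a where a: "insert h (s ` {1..m}) = {a..a + int m}"
    using col by (auto simp: wheel_colouring_def)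
  have spokes: "inj_on s {1..m} \<and> h \<notin> s ` {1..m}"
  proof -
    have "card (insert h (s ` {1..m})) = Suc m" unfolding a by simp
    moreover have "card (s ` {1..m}) \<le> m" using card_image_le[of "{1..m}" s] by simp
    ultimately have "h \<notin> s ` {1..m}" "card (s ` {1..m}) = card {1..m}"
      by (auto simp: card_insert_if split: if_splits)
    then show ?thesis using eq_card_imp_inj_on by blast
  qed
  have rim: "c i \<noteq> h" "c i \<noteq> c (succ_rim m i)" "\<exists>x. {c i, s i, r i, r (pred_rim m i)} = {x..x + 3}"
    if "i \<in> {1..m}" for i
    using col that unfolding wheel_colouring_def by blast+
  interpret wheel_walk "int m" h a "\<lambda>k. c (idx k)" "\<lambda>k. s (idx k)" "\<lambda>k. r (idx k)"
  proof
    fix j k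
    show "int m dvd j - k \<Longrightarrow> c (idx j) = c (idx k) \<and> s (idx j) = s (idx k) \<and> r (idx j) = r (idx k)"
      using idx_eq[of j k] by simp
    show "s (idx j) = s (idx k) \<Longrightarrow> int m dvd j - k"
      using spokes idx_range idx_eq by (metis inj_onD)
    have "range (\<lambda>k. s (idx k)) = s ` range idx" by (simp only: image_image)
    then show "insert h (range (\<lambda>k. s (idx k))) = {a..a + int m}"
      by (simp only: surj a)
    show "s (idx k) \<noteq> h" using spokes idx_range by blast
    show "c (idx k) \<noteq> h" using rim idx_range by blast
    show "c (idx k) \<noteq> c (idx (k + 1))" using rim(2)[OF idx_range] unfolding succ .
    show "\<exists>x. {c (idx k), s (idx k), r (idx k), r (idx (k - 1))} = {x..x + 3}"
      using rim(3)[OF idx_range] unfolding pred .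
  qed (use m in simp)
  have "range (\<lambda>k. f (idx k)) = f ` {1..m}" for f :: "nat \<Rightarrow> int"
    using surj by (metis image_image)
  then have "insert h (range (\<lambda>k. c (idx k)) \<union> range (\<lambda>k. s (idx k)) \<union> range (\<lambda>k. r (idx k))) = {lo..hi}"
    using colours by (simp only: wheel_colours_def)
  then show ?thesis using spread by simp
qed

subsection \<open>Constructions\<close>

text \<open>The rim vertices are labelled by \<open>0, \<dots>, m - 1\<close> such that \<open>0\<close> and \<open>1\<close>, \<open>j\<close> and \<open>j + 2\<close>,
  and \<open>m - 2\<close> and \<open>m - 1\<close> are adjacent; \<open>E j\<close> is the colour of the rim edge that joins \<open>j\<close> to its
  neighbour of smaller label, and \<open>E m\<close> that of the edge between \<open>m - 2\<close> and \<open>m - 1\<close>.\<close>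

lemma colourable_if_zigzag:
  fixes C S E :: "nat \<Rightarrow> int"
  assumes m: "3 \<le> m"
    and hub: "insert h (S ` {..<m}) = {a..a + int m}"
    and rim: "\<And>j. j < m \<Longrightarrow> \<exists>x. {C j, S j, E (if j = 0 then 1 else j), E (if j = m - 1 then m else j + 2)} = {x..x + 3}"
    and C_h: "\<And>j. j < m \<Longrightarrow> C j \<noteq> h"
    and C_adj: "C 0 \<noteq> C 1" "\<And>j. j + 2 < m \<Longrightarrow> C j \<noteq> C (j + 2)" "C (m - 2) \<noteq> C (m - 1)"
    and colours: "insert h (C ` {..<m} \<union> S ` {..<m} \<union> E ` {1..m}) = {lo..hi}"
  shows "wheel (Suc m) \<in> \<TT>\<^bsub>nat (hi - lo + 1)\<^esub>"
proof -
  \<comment> \<open>Labels run \<open>0, 2, 4, ...\<close> on the first half of the rim and descend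
    through the odd numbers to \<open>1\<close> on the second. \<open>el p\<close> is the larger
    vertex label on the edge from \<open>p\<close> to its successor, except that the edge where the
    halves meet is labelled \<open>m\<close>.\<close>
  define vl where "vl p = (if 2 * p \<le> m + 1 then 2 * p - 2 else 2 * (m - p) + 1)" for p
  define el where "el p = (if 2 * p < m then 2 * p else if 2 * p \<le> m + 1 then m else 2 * (m - p) + 1)" for p
  have vl: "vl ` {1..m} = {..<m}"
  proof (intro equalityI subsetI)
    fix j assume j: "j \<in> {..<m}"
    show "j \<in> vl ` {1..m}"
    proof (cases "even j")
      case True
      then obtain q where "j = 2 * q" by blast
      then show ?thesis using j by (intro image_eqI[of _ _ "q + 1"]) (auto simp: vl_def)
    next
      case False
      then obtain q where "j = 2 * q + 1" by (rule oddE)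
      then show ?thesis using j by (intro image_eqI[of _ _ "m - q"]) (auto simp: vl_def)
    qed
  qed (auto simp: vl_def)
  have el: "el ` {1..m} = {1..m}"
  proof (intro equalityI subsetI)
    fix j assume j: "j \<in> {1..m}"
    show "j \<in> el ` {1..m}"
    proof (cases "j = m")
      case True
      then show ?thesis using m by (intro image_eqI[of _ _ "(m + 1) div 2"]) (auto simp: el_def)
    next
      case False
      show ?thesis
      proof (cases "even j")
        case True
        then obtain q where "j = 2 * q" by blast
        then show ?thesis using j False by (intro image_eqI[of _ _ q]) (auto simp: el_def)
      next
        case odd: False
        then obtain q where "j = 2 * q + 1" by (rule oddE)
        then show ?thesis using j False by (intro image_eqI[of _ _ "m - q"]) (auto simp: el_def)
      qed
    qed
  qed (use m in \<open>auto simp: el_def\<close>)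
  have edges: "{el p, el (pred_rim m p)} = {if vl p = 0 then 1 else vl p, if vl p = m - 1 then m else vl p + 2}"
    if "p \<in> {1..m}" for p
  \<comment> \<open>Labels rise on the first half and fall on the second, so the two edges at
    \<open>p\<close> swap roles.\<close>
  proof (cases "2 * p \<le> m + 1")
    case True
    have "el p = (if vl p = m - 1 then m else vl p + 2)" "el (pred_rim m p) = (if vl p = 0 then 1 else vl p)"
      using True that m by (auto simp: vl_def el_def pred_rim_def)
    then show ?thesis by auto
  next
    case False
    have "el (pred_rim m p) = (if vl p = m - 1 then m else vl p + 2)" "el p = (if vl p = 0 then 1 else vl p)"
      using False that m by (auto simp: vl_def el_def pred_rim_def)
    then show ?thesis by auto
  qed
  have adj: "C (vl p) \<noteq> C (vl (succ_rim m p))" if p: "p \<in> {1..m}" for p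
  proof -
    consider "p = m" | "p < m" "2 * p + 2 \<le> m + 1" | "p < m" "2 * p = m \<or> 2 * p = m + 1" | "p < m" "m + 1 < 2 * p"
      using p by fastforce
    then show ?thesis
    proof cases
      case 1
      then have "vl p = 1" "vl (succ_rim m p) = 0" using m by (auto simp: vl_def succ_rim_def)
      then show ?thesis using C_adj(1) by simp
    next
      case 2
      then have "vl p + 2 < m" "vl (succ_rim m p) = vl p + 2" using p by (auto simp: vl_def succ_rim_def)
      then show ?thesis using C_adj(2)[of "vl p"] by simp
    next
      case 3
      then have "(vl p = m - 2 \<and> vl (succ_rim m p) = m - 1) \<or> (vl p = m - 1 \<and> vl (succ_rim m p) = m - 2)"
        using p by (auto simp: vl_def succ_rim_def)
      then show ?thesis using C_adj(3) by auto
    next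
      case 4
      then have "vl (succ_rim m p) + 2 < m" "vl p = vl (succ_rim m p) + 2" using p by (auto simp: vl_def succ_rim_def)
      then show ?thesis using C_adj(2)[of "vl (succ_rim m p)"] by simp
    qed
  qed
  have "wheel_colouring m h (\<lambda>p. C (vl p)) (\<lambda>p. S (vl p)) (\<lambda>p. E (el p))"
    unfolding wheel_colouring_def
  proof (intro conjI ballI)
    have "(\<lambda>p. S (vl p)) ` {1..m} = S ` vl ` {1..m}" by (simp only: image_image)
    then show "\<exists>a. insert h ((\<lambda>p. S (vl p)) ` {1..m}) = {a..a + int m}"
      using hub unfolding vl by auto
  next
    fix p assume p: "p \<in> {1..m}"
    then have j: "vl p < m" using vl by blast
    show "C (vl p) \<noteq> h" using C_h[OF j] .
    show "C (vl p) \<noteq> C (vl (succ_rim m p))" using adj[OF p] .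
    have "{C (vl p), S (vl p), E (el p), E (el (pred_rim m p))} = {C (vl p), S (vl p)} \<union> E ` {el p, el (pred_rim m p)}"
      by auto
    also have "\<dots> = {C (vl p), S (vl p), E (if vl p = 0 then 1 else vl p), E (if vl p = m - 1 then m else vl p + 2)}"
      unfolding edges[OF p] by auto
    finally show "\<exists>x. {C (vl p), S (vl p), E (el p), E (el (pred_rim m p))} = {x..x + 3}"
      using rim[OF j] by (simp only:)
  qed
  moreover have "wheel_colours m h (\<lambda>p. C (vl p)) (\<lambda>p. S (vl p)) (\<lambda>p. E (el p)) = {lo..hi}"
  proof -
    have "(\<lambda>p. f (vl p)) ` {1..m} = f ` {..<m}" "(\<lambda>p. f (el p)) ` {1..m} = f ` {1..m}" for f :: "nat \<Rightarrow> int"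
      using vl el by (metis image_image)+
    then show ?thesis using colours by (simp only: wheel_colours_def)
  qed
  ultimately show ?thesis by (rule colourable_if_wheel_colouring[OF m])
qed

lemma image_int_lessThan: "int ` {..<m} = {0..int m - 1}"
  by (auto simp: image_iff) (metis lessThan_iff nat_0_le nat_less_iff zle_diff1_eq zero_le_imp_eq_int of_nat_less_iff)

lemma consecutive4: "{x..x + 3} = {x, x + 1, x + 2, x + 3}" for x :: int
  by auto

text \<open>The middle piece will be the hub palette, so only the few colours beyond it need
  witnesses.\<close>

lemma eq_intervalI:
  fixes lo hi :: int
  assumes "A \<subseteq> {lo..hi}" "{x..y} \<subseteq> A" "{lo..<x} \<subseteq> A" "{y<..hi} \<subseteq> A"
  shows "A = {lo..hi}"
proof
  have "{lo..hi} \<subseteq> {lo..<x} \<union> {x..y} \<union> {y<..hi}" by auto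
  then show "{lo..hi} \<subseteq> A" using assms by blast
qed (rule assms(1))

text \<open>Spoke \<open>j\<close> gets colour \<open>j\<close> and the hub \<open>m\<close>. For
  \<open>k = 0\<close> the colours at vertex \<open>0\<close> are \<open>-3..0\<close>; each
  increase of \<open>k\<close> lifts the lowest of them by 4, which keeps that palette an interval
  and drops the least colour overall. For \<open>m = 3\<close> and \<open>1 \<le> k\<close> the
  adjacent labels \<open>0\<close> and \<open>2\<close> would both be coloured
  \<open>1\<close>.\<close>

lemma wheel_colourable_short:
  assumes "k \<le> 3" "3 \<le> m" "m = 3 \<longrightarrow> k = 0"
  shows "wheel (Suc m) \<in> \<TT>\<^bsub>m + 4 - k\<^esub>"
proof -
  define E :: "nat \<Rightarrow> int" where
    "E j = (if j = 1 then (if k \<le> 1 then - 2 else 2) else if j = 2 then (if k \<le> 2 then - 1 else 3) else int j - 3)" for j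
  define C :: "nat \<Rightarrow> int" where
    "C j = (if j = 0 then (if k = 0 then - 3 else 1) else if j = 1 then (if k \<le> 2 then - 1 else 3)
      else if j = m - 1 then int m - 2 else int j - 2)" for j
  define x :: "nat \<Rightarrow> int" where
    "x j = (if j = 0 then int k - 3 else if j = 1 then (if k \<le> 1 then - 2 else int k - 3) else if j = 2 then (if k \<le> 2 then - 1 else 0) else int j - 3)" for j
  let ?U = "insert (int m) (C ` {..<m} \<union> int ` {..<m} \<union> E ` {1..m})"
  have k: "k = 0 \<or> k = 1 \<or> k = 2 \<or> k = 3" using assms(1) by auto
  have hub: "insert (int m) (int ` {..<m}) = {0..0 + int m}"
    unfolding image_int_lessThan by auto
  have "wheel (Suc m) \<in> \<TT>\<^bsub>nat (int m - (int k - 3) + 1)\<^esub>"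
  proof (rule colourable_if_zigzag[OF assms(2) hub])
    fix j assume "j < m"
    then consider "j = 0" | "j = 1" | "j = 2" "j < m - 1" | "j = m - 1" "j \<ge> 2" | "3 \<le> j" "j < m - 1"
      by linarith
    then have "{C j, int j, E (if j = 0 then 1 else j), E (if j = m - 1 then m else j + 2)} = {x j..x j + 3}"
      unfolding consecutive4
      using assms k by cases (auto simp: C_def E_def x_def)
    then show "\<exists>x. {C j, int j, E (if j = 0 then 1 else j), E (if j = m - 1 then m else j + 2)} = {x..x + 3}"
      by blast
  next
    show "C j \<noteq> int m" if "j < m" for j
      using assms that by (auto simp: C_def)
    show "C 0 \<noteq> C 1" "C (m - 2) \<noteq> C (m - 1)"
      using assms by (auto simp: C_def)
    show "C j \<noteq> C (j + 2)" if "j + 2 < m" for j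
      using assms that by (auto simp: C_def)
  next
    show "?U = {int k - 3..int m}"
    proof (rule eq_intervalI)
      show "?U \<subseteq> {int k - 3..int m}"
        using assms by (auto simp: C_def E_def)
      show "{0..int m} \<subseteq> ?U" using hub by auto
      show "{int k - 3..<0} \<subseteq> ?U"
      proof
        fix y assume y: "y \<in> {int k - 3..<0}"
        then consider "y = - 3" "k = 0" | "y = - 2" "k \<le> 1" | "y = - 1" "k \<le> 2" by fastforce
        then have "y = C 0 \<or> y = E 1 \<or> y = E 2" by cases (auto simp: C_def E_def)
        then show "y \<in> ?U" using assms by auto
      qed
    qed simp
  qed
  moreover have "nat (int m - (int k - 3) + 1) = m + 4 - k" using assms by linarith
  ultimately show ?thesis by simp
qed

text \<open>The hub gets colour \<open>m - 4\<close>, and so do the two rim edges between a smaller and a larger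
  spoke colour, as the upper bound dictates.\<close>

lemma wheel_colourable_long:
  assumes "8 \<le> m"
  shows "wheel (Suc m) \<in> \<TT>\<^bsub>m + 5\<^esub>"
proof -
  \<comment> \<open>For \<open>G = 0\<close> the rim has eight vertices; larger \<open>G\<close>
    inserts the \<open>G\<close> regular labels \<open>2\<close> to \<open>G + 1\<close>.\<close>
  define G where "G = m - 8"
  have m: "m = G + 8" using assms by (simp add: G_def)
  \<comment> \<open>Colour \<open>G + 4\<close> is reserved for the hub, so the labels
    \<open>G + 4\<close> and \<open>G + 6\<close>, on the same arc, shift up by 2.\<close>
  define S :: "nat \<Rightarrow> int" where
    "S j = int (if j = G + 4 then G + 6 else if j = G + 6 then G + 8 else j)" for j
  define E :: "nat \<Rightarrow> int" where
    "E j = (if j = 1 then - 1 else if j = G + 4 \<or> j = G + 5 then int G + 4 else if j = G + 6 then int G + 7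
      else if j = G + 7 then int G + 6 else if j = G + 8 then int G + 9 else int j - 1)" for j
  define C :: "nat \<Rightarrow> int" where
    "C j = (if j = 0 then - 2 else if j = 1 then 0 else if j = G + 2 then int G + 3 else if j = G + 4 then int G + 5
      else if j = G + 5 then int G + 3 else if j = G + 6 then int G + 10 else if j = G + 7 then int G + 8
      else int j + 2)" for j
  define x :: "nat \<Rightarrow> int" where
    "x j = (if j = 0 then - 2 else if j = 1 then - 1 else if j = G + 2 then int G + 1 else if j = G + 4 then int G + 4
      else if j = G + 5 then int G + 3 else if j = G + 6 then int G + 7 else if j = G + 7 then int G + 6
      else int j - 1)" for j
  let ?U = "insert (int (G + 4)) (C ` {..<m} \<union> S ` {..<m} \<union> E ` {1..m})"
  have hub: "insert (int (G + 4)) (S ` {..<m}) = {0..0 + int m}"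
  proof -
    have "{..<m} = {..<G + 4} \<union> {G + 4, G + 5, G + 6, G + 7}" unfolding m by auto
    moreover have "S ` {..<G + 4} = int ` {..<G + 4}" by (auto simp: S_def)
    then have "S ` {..<G + 4} = {0..int G + 3}" by (simp add: image_int_lessThan)
    ultimately have "insert (int (G + 4)) (S ` {..<m}) = {0..int G + 3} \<union> {int G + 4, int G + 5, int G + 6, int G + 7, int G + 8}"
      by (auto simp: image_Un S_def)
    also have "\<dots> = {0..0 + int m}" unfolding m by auto
    finally show ?thesis .
  qed
  have "wheel (Suc m) \<in> \<TT>\<^bsub>nat ((int m + 2) - (- 2) + 1)\<^esub>"
  proof (rule colourable_if_zigzag[OF _ hub])
    show "3 \<le> m" using assms by simp
  next
    fix j assume "j < m"
    then have "G + 4 \<le> j \<Longrightarrow> j = G + 4 \<or> j = G + 5 \<or> j = G + 6 \<or> j = G + 7" unfolding m by arith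
    moreover have "2 \<le> j \<Longrightarrow> j < G + 4 \<Longrightarrow> j < G + 2 \<or> j = G + 2 \<or> j = G + 3" by arith
    moreover have "j = 0 \<or> j = 1 \<or> 2 \<le> j" by arith
    ultimately consider "j = 0" | "j = 1" | "2 \<le> j" "j < G + 2" | "j = G + 2" | "j = G + 3" | "j = G + 4" | "j = G + 5"
      | "j = G + 6" | "j = G + 7"
      using not_le by blast
    then have "{C j, S j, E (if j = 0 then 1 else j), E (if j = m - 1 then m else j + 2)} = {x j..x j + 3}"
    proof cases
      case 1
      then show ?thesis unfolding consecutive4 by (auto simp: C_def E_def x_def S_def m)
    next
      case 2
      then show ?thesis unfolding consecutive4 by (auto simp: C_def E_def x_def S_def m)
    next
      case 3
      then have "C j = int j + 2" "S j = int j" "E j = int j - 1" "E (j + 2) = int j + 1" "x j = int j - 1"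
        "j \<noteq> 0" "j \<noteq> m - 1"
        by (simp_all add: C_def E_def x_def S_def m)
      then show ?thesis unfolding consecutive4 by auto
    qed (auto simp: consecutive4 C_def E_def x_def S_def m)
    then show "\<exists>x. {C j, S j, E (if j = 0 then 1 else j), E (if j = m - 1 then m else j + 2)} = {x..x + 3}"
      by blast
  next
    show "C j \<noteq> int (G + 4)" if "j < m" for j
      using that unfolding m by (auto simp: C_def)
    show "C 0 \<noteq> C 1" "C (m - 2) \<noteq> C (m - 1)"
      unfolding m by (auto simp: C_def)
    show "C j \<noteq> C (j + 2)" if "j + 2 < m" for j
      using that unfolding m by (auto simp: C_def)
  next
    show "?U = {- 2..int m + 2}"
    proof (rule eq_intervalI)
      show "?U \<subseteq> {- 2..int m + 2}"
        unfolding m by (auto simp: C_def E_def S_def)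
      show "{0..int m} \<subseteq> ?U" using hub by auto
      have "C 0 \<in> ?U" "E 1 \<in> ?U" using assms by auto
      moreover have "C 0 = - 2" "E 1 = - 1" by (auto simp: C_def E_def)
      moreover have "{- 2..<0::int} = {- 2, - 1}" by auto
      ultimately show "{- 2..<0} \<subseteq> ?U" by (simp only: insert_subset empty_subsetI)
      have "C (G + 6) \<in> ?U" "E (G + 8) \<in> ?U" unfolding m by auto
      moreover have "C (G + 6) = int m + 2" "E (G + 8) = int m + 1" by (auto simp: C_def E_def m)
      moreover have "{int m<..int m + 2} = {int m + 1, int m + 2}" by auto
      ultimately show "{int m<..int m + 2} \<subseteq> ?U" by (simp only: insert_subset empty_subsetI)
    qed
  qed
  moreover have "nat ((int m + 2) - (- 2) + 1) = m + 5" by linarith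
  ultimately show ?thesis by simp
qed

text \<open>Fills a gap left by \<open>wheel_colourable_short\<close>, here with the hub at the
  bottom of its palette.\<close>

lemma K4_colourable: "wheel 4 \<in> \<TT>\<^bsub>6\<^esub>"
proof -
  define S :: "nat \<Rightarrow> int" where "S j = int j + 1" for j
  define C :: "nat \<Rightarrow> int" where "C j = (if j = 0 then - 1 else if j = 1 then 3 else 4)" for j
  define E :: "nat \<Rightarrow> int" where "E j = (if j = 1 then 0 else if j = 2 then 2 else 1)" for j
  have lt3: "{..<3::nat} = {0, 1, 2}" and le3: "{1..3::nat} = {1, 2, 3}" by auto
  have "wheel (Suc 3) \<in> \<TT>\<^bsub>nat (4 - (- 1) + 1)\<^esub>"
  proof (rule colourable_if_zigzag)
    show "insert 0 (S ` {..<3}) = {0..0 + int 3}" unfolding lt3 by (auto simp: S_def)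
    fix j :: nat assume "j < 3"
    then have j: "j = 0 \<or> j = 1 \<or> j = 2" by auto
    then have "{C j, S j, E (if j = 0 then 1 else j), E (if j = 3 - 1 then 3 else j + 2)}
      = {int j - 1..int j - 1 + 3}"
      unfolding consecutive4 by (auto simp: S_def C_def E_def)
    then show "\<exists>x. {C j, S j, E (if j = 0 then 1 else j), E (if j = 3 - 1 then 3 else j + 2)} = {x..x + 3}"
      by blast
  next
    show "insert 0 (C ` {..<3} \<union> S ` {..<3} \<union> E ` {1..3}) = {- 1..4}"
      unfolding lt3 le3 by (auto simp: S_def C_def E_def)
  qed (auto simp: C_def)
  then show ?thesis by simp
qed

subsection \<open>The theorem\<close>

text \<open>With at most five colours every palette contains the middle three, and a colour that occurs
  at all four vertices of \<open>K\<^sub>4\<close> cannot be a vertex colour.\<close>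

lemma K4_min_colours:
  assumes col: "wheel_colouring 3 h c s r" and colours: "wheel_colours 3 h c s r = {1..t}"
  shows "6 \<le> t"
proof (rule ccontr)
  assume t: "\<not> 6 \<le> t"
  have I: "{1..3::nat} = {1, 2, 3}" by auto
  have range: "1 \<le> x \<and> x \<le> 5" if "x \<in> wheel_colours 3 h c s r" for x
    using that t unfolding colours by auto
  obtain a0 where p0: "{h, s 1, s 2, s 3} = {a0..a0 + 3}"
    using col unfolding wheel_colouring_def I by auto
  have rim: "c i \<noteq> h \<and> c i \<noteq> c (succ_rim 3 i) \<and> (\<exists>x. {c i, s i, r i, r (pred_rim 3 i)} = {x..x + 3})"
    if "i \<in> {1, 2, 3}" for i
    using col that unfolding wheel_colouring_def I by blast
  obtain a1 where p1: "{c 1, s 1, r 1, r 3} = {a1..a1 + 3}"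
    using rim[of 1] by (auto simp: pred_rim_def)
  obtain a2 where p2: "{c 2, s 2, r 2, r 1} = {a2..a2 + 3}"
    using rim[of 2] by (auto simp: pred_rim_def)
  obtain a3 where p3: "{c 3, s 3, r 3, r 2} = {a3..a3 + 3}"
    using rim[of 3] by (auto simp: pred_rim_def)
  have succ: "succ_rim 3 1 = 2" "succ_rim 3 2 = 3" "succ_rim 3 3 = 1" by (simp_all add: succ_rim_def)
  have proper: "c 1 \<noteq> h" "c 2 \<noteq> h" "c 3 \<noteq> h" "c 1 \<noteq> c 2" "c 2 \<noteq> c 3" "c 3 \<noteq> c 1"
    using rim[of 1] rim[of 2] rim[of 3] unfolding succ by auto
  have sub: "{h, s 1, s 2, s 3} \<subseteq> wheel_colours 3 h c s r" "{c 1, s 1, r 1, r 3} \<subseteq> wheel_colours 3 h c s r"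
    "{c 2, s 2, r 2, r 1} \<subseteq> wheel_colours 3 h c s r" "{c 3, s 3, r 3, r 2} \<subseteq> wheel_colours 3 h c s r"
    unfolding wheel_colours_def I by auto
  \<comment> \<open>Four consecutive colours inside \<open>{1..5}\<close> start at 1 or 2, so they
    include 2, 3 and 4.\<close>
  have a: "a = 1 \<or> a = 2" if "{a..a + 3} \<subseteq> wheel_colours 3 h c s r" for a
  proof -
    have "a \<in> {a..a + 3}" "a + 3 \<in> {a..a + 3}" by auto
    then show ?thesis using range[of a] range[of "a + 3"] subsetD[OF that] by fastforce
  qed
  note as = a[OF sub(1)[unfolded p0]] a[OF sub(2)[unfolded p1]] a[OF sub(3)[unfolded p2]] a[OF sub(4)[unfolded p3]]
  have mid: "(x = h \<or> x = s 1 \<or> x = s 2 \<or> x = s 3) \<and> (x = c 1 \<or> x = s 1 \<or> x = r 1 \<or> x = r 3) \<and>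
    (x = c 2 \<or> x = s 2 \<or> x = r 2 \<or> x = r 1) \<and> (x = c 3 \<or> x = s 3 \<or> x = r 3 \<or> x = r 2)" if "x \<in> {2, 3, 4}" for x
    using four_consecutive(3)[OF p0, of x] four_consecutive(3)[OF p1, of x]
      four_consecutive(3)[OF p2, of x] four_consecutive(3)[OF p3, of x] as that by auto
  have dist: "distinct [h, s 1, s 2, s 3]" "distinct [c 1, s 1, r 1, r 3]"
    "distinct [c 2, s 2, r 2, r 1]" "distinct [c 3, s 3, r 3, r 2]"
    using four_consecutive(1) p0 p1 p2 p3 by blast+
  \<comment> \<open>If one vertex had colour \<open>x\<close>, the other three would have to receive
    \<open>x\<close> from edges among themselves, but edges of one colour are disjoint and cannot
    cover exactly three vertices.\<close>
  have "x \<noteq> h \<and> x \<noteq> c 1 \<and> x \<noteq> c 2 \<and> x \<noteq> c 3" if "x \<in> {2, 3, 4}" for x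
    using mid[OF that] dist proper by auto
  then have "{h, c 1, c 2, c 3} \<inter> {2, 3, 4} = {}" by blast
  moreover have "{h, c 1, c 2, c 3} \<subseteq> {1..5}"
    using range sub by auto
  moreover have "{1..5::int} = {1, 2, 3, 4, 5}" by auto
  ultimately have "{h, c 1, c 2, c 3} \<subseteq> {1, 5}" by auto
  then show False using proper by auto
qed

text \<open>The hub palette alone takes \<open>Suc m\<close> colours; the upper bounds apply the
  spread estimate to \<open>t - 1\<close>.\<close>

lemma colourable_bounds:
  assumes m: "3 \<le> m" and t: "wheel (Suc m) \<in> \<TT>\<^bsub>t\<^esub>"
  shows "Suc m \<le> t" "m = 3 \<Longrightarrow> 6 \<le> t" "t \<le> m + 5" "m < 8 \<Longrightarrow> t \<le> m + 4"
proof -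
  obtain h c s r where col: "wheel_colouring m h c s r" "wheel_colours m h c s r = {1..int t}"
    using wheel_colouring_if_colourable[OF m t] .
  obtain a where "insert h (s ` {1..m}) = {a..a + int m}"
    using col(1) unfolding wheel_colouring_def by blast
  moreover have "insert h (s ` {1..m}) \<subseteq> {1..int t}"
    unfolding col(2)[symmetric] by (auto simp: wheel_colours_def)
  ultimately show "Suc m \<le> t" by auto
  show "6 \<le> t" if "m = 3" using K4_min_colours[of h c s r "int t"] col that by simp
  show "t \<le> m + 5" "m < 8 \<Longrightarrow> t \<le> m + 4"
    using spread_wheel_colouring[OF m col] by auto
qed

theorem theorem12:
  fixes n :: nat
  assumes "n \<ge> 4"
  shows "wheel n \<in> \<TT>
    \<and> w_tau (wheel n) = (if n = 4 then n + 2 else n)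
    \<and> W_tau (wheel n) = (if n \<le> 8 then n + 3 else n + 4)
    \<and> (\<forall>t. w_tau (wheel n) \<le> t \<and> t \<le> W_tau (wheel n) \<longrightarrow> wheel n \<in> \<TT>\<^bsub>t\<^esub>)"
proof -
  obtain m where n: "n = Suc m" and m: "3 \<le> m"
    using assms by (cases n) auto
  define lo where "lo = (if n = 4 then n + 2 else n)"
  define hi where "hi = (if n \<le> 8 then n + 3 else n + 4)"
  have bounds: "lo \<le> t \<and> t \<le> hi" if "wheel n \<in> \<TT>\<^bsub>t\<^esub>" for t
    using colourable_bounds[OF m that[unfolded n]] by (auto simp: lo_def hi_def n)
  have colourable: "wheel n \<in> \<TT>\<^bsub>t\<^esub>" if t: "lo \<le> t" "t \<le> hi" for t
  proof -
    \<comment> \<open>\<open>wheel_colourable_short\<close> covers \<open>m + 1\<close> to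
      \<open>m + 4\<close> colours; \<open>K_4\<close> with six colours is its one gap within the
      bounds, and \<open>m + 5\<close> lies above its range.\<close>
    consider "n = 4" "t = 6" | "t = m + 5" "8 \<le> m" | "t \<le> m + 4" "m + 1 \<le> t" "m = 3 \<longrightarrow> t = m + 4"
      using t m unfolding lo_def hi_def n by (fastforce split: if_splits)
    then show ?thesis
    proof cases
      case 1
      then show ?thesis using K4_colourable by simp
    next
      case 2
      then show ?thesis using wheel_colourable_long n by simp
    next
      case 3
      then show ?thesis using wheel_colourable_short[of "m + 4 - t" m] m n by simp
    qed
  qed
  have "lo \<le> hi" "1 \<le> lo" using assms by (auto simp: lo_def hi_def)
  have "w_tau (wheel n) = lo"
    unfolding w_tau_def
    by (rule Least_equality) (rule colourable[OF order_refl \<open>lo \<le> hi\<close>], rule conjunct1[OF bounds])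
  moreover have "W_tau (wheel n) = hi"
    unfolding W_tau_def
    by (rule Greatest_equality) (rule colourable[OF \<open>lo \<le> hi\<close> order_refl], rule conjunct2[OF bounds])
  moreover have "wheel n \<in> \<TT>"
    unfolding interval_total_graphs_def
    using colourable[OF order_refl \<open>lo \<le> hi\<close>] \<open>1 \<le> lo\<close> by (intro UN_I) simp_all
  ultimately show ?thesis
    unfolding lo_def[symmetric] hi_def[symmetric] by (simp add: colourable)
qed

end
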